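(* Let $d_1,\dots,d_l\ge 2$ be natural numbers. The Hilbertian tensor product $\otimes_2:\mathcal{E}(d_1)\times\cdots\times\mathcal{E}(d_l)\to\mathcal{E}_\otimes(d_1,\dots,d_l)$, $(E_1,\dots,E_l)\mapsto E_1\otimes_2\cdots\otimes_2E_l$, is continuous with respect to the Hausdorff distance.
   Context: For $d\in\mathbb{N}$, $\mathbb{R}^d$ carries its standard inner product, with closed unit ball $B_2^d$. The tensor product $\otimes_{i=1}^l\mathbb{R}^{d_i}$ carries the inner product $\langle\cdot,\cdot\rangle_H$ determined by $\langle x^1\otimes\cdots\otimes x^l,y^1\otimes\cdots\otimes y^l\rangle_H=\prod_{i=1}^l\langle x^i,y^i\rangle$, with closed unit ball $B_2^{d_1,\dots,d_l}$. A 0-symmetric convex body is a compact convex set $P$ with nonempty interior and $P=-P$; $\mathcal{B}(d)$ is the set of these in $\mathbb{R}^d$, and $\mathcal{E}(d)$ is the set of 0-symmetric ellipsoids $T(B_2^d)$, $T\in GL(d)$, with the Hausdorff distance. For $E_i=T_i(B_2^{d_i})\in\mathcal{E}(d_i)$ with $T_i\in GL(d_i)$, $E_1\otimes_2\cdots\otimes_2E_l:=(T_1\otimes\cdots\otimes T_l)(B_2^{d_1,\dots,d_l})$, which does not depend on the choice of the $T_i$. For $P_i\in\mathcal{B}(d_i)$, let $P_1\otimes_\pi\cdots\otimes_\pi P_l:=\mathrm{conv}\{x^1\otimes\cdots\otimes x^l: x^i\in P_i\}$ and $P_1\otimes_\epsilon\cdots\otimes_\epsilon P_l:=(P_1^\circ\otimes_\pi\cdots\otimes_\pi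 P_l^\circ)^\circ$, where $P^\circ=\{y:\langle x,y\rangle\le 1\ \forall x\in P\}$ (using $\langle\cdot,\cdot\rangle_H$ in the tensor product). A 0-symmetric convex body $P\subset\otimes_{i=1}^l\mathbb{R}^{d_i}$ is a tensorial body if there are $P_i\in\mathcal{B}(d_i)$ with $P_1\otimes_\pi\cdots\otimes_\pi P_l\subseteq P\subseteq P_1\otimes_\epsilon\cdots\otimes_\epsilon P_l$. $\mathcal{E}_\otimes(d_1,\dots,d_l)$ is the set of 0-symmetric ellipsoids in $\otimes_{i=1}^l\mathbb{R}^{d_i}$ (images of $B_2^{d_1,\dots,d_l}$ under linear isomorphisms) that are tensorial bodies, with the Hausdorff distance induced by the Euclidean norm of $\langle\cdot,\cdot\rangle_H$. It is known that $E_1\otimes_2\cdots\otimes_2E_l\in\mathcal{E}_\otimes(d_1,\dots,d_l)$. *)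

theory Defs
  imports "HOL-Analysis.Analysis"
begin

section \<open>Euclidean coordinate spaces of arbitrary finite dimension\<close>

text \<open>
  The dimensions in a tensor product of finitely many spaces vary with the factor, so they
  cannot be indexed by types.  Instead all the spaces live inside one inner product
  space: the finitely supported real functions on an index type.  For a finite set \<open>I\<close> of
  indices, \<open>coord_space I\<close> is the Euclidean space with coordinates in \<open>I\<close>.
\<close>

typedef 'a fvec = "{f :: 'a \<Rightarrow> real. finite {a. f a \<noteq> 0}}"
  morphisms coord Abs_fvec
  by (rule exI[of _ "\<lambda>_. 0"]) simp

setup_lifting type_definition_fvec

lemma finite_support_coord [simp]: "finite {a. coord x a \<noteq> 0}"
  using coord by blast

lemma fvec_eqI: "(\<And>a. coord x a = coord y a) \<Longrightarrow> x = y"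
  by transfer auto

instantiation fvec :: (type) real_vector
begin

lift_definition zero_fvec :: "'a fvec" is "\<lambda>_. 0" by simp

lift_definition plus_fvec :: "'a fvec \<Rightarrow> 'a fvec \<Rightarrow> 'a fvec" is "\<lambda>f g a. f a + g a"
  subgoal for f g by (rule finite_subset[of _ "{a. f a \<noteq> 0} \<union> {a. g a \<noteq> 0}"]) auto
  done

lift_definition minus_fvec :: "'a fvec \<Rightarrow> 'a fvec \<Rightarrow> 'a fvec" is "\<lambda>f g a. f a - g a"
  subgoal for f g by (rule finite_subset[of _ "{a. f a \<noteq> 0} \<union> {a. g a \<noteq> 0}"]) auto
  done

lift_definition uminus_fvec :: "'a fvec \<Rightarrow> 'a fvec" is "\<lambda>f a. - f a"
  by simp

lift_definition scaleR_fvec :: "real \<Rightarrow> 'a fvec \<Rightarrow> 'a fvec" is "\<lambda>r f a. r * f a"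
  by (rule rev_finite_subset) auto

instance
  by standard (transfer; simp add: fun_eq_iff algebra_simps)+

end

lemma coord_simps [simp]:
  "coord 0 a = 0" "coord (x + y) a = coord x a + coord y a"
  "coord (x - y) a = coord x a - coord y a" "coord (- x) a = - coord x a"
  "coord (r *\<^sub>R x) a = r * coord x a"
  by (transfer, simp)+

lemma coord_sum [simp]: "coord (\<Sum>i\<in>A. f i) a = (\<Sum>i\<in>A. coord (f i) a)"
  by (induction A rule: infinite_finite_induct) auto

instantiation fvec :: (type) real_inner
begin

definition inner_fvec :: "'a fvec \<Rightarrow> 'a fvec \<Rightarrow> real"
  where "inner_fvec x y = (\<Sum>a | coord x a \<noteq> 0. coord x a * coord y a)"

definition norm_fvec :: "'a fvec \<Rightarrow> real"
  where "norm_fvec x = sqrt (inner x x)"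

definition sgn_fvec :: "'a fvec \<Rightarrow> 'a fvec"
  where "sgn_fvec x = x /\<^sub>R norm x"

definition dist_fvec :: "'a fvec \<Rightarrow> 'a fvec \<Rightarrow> real"
  where "dist_fvec x y = norm (x - y)"

definition uniformity_fvec :: "('a fvec \<times> 'a fvec) filter"
  where "uniformity_fvec = (INF e\<in>{0<..}. principal {(x, y). dist x y < e})"

definition open_fvec :: "'a fvec set \<Rightarrow> bool"
  where "open_fvec U \<longleftrightarrow> (\<forall>x\<in>U. eventually (\<lambda>(x', y). x' = x \<longrightarrow> y \<in> U) uniformity)"

lemma inner_fvec_superset:
  assumes "finite I" "\<And>a. a \<notin> I \<Longrightarrow> coord x a = 0 \<or> coord y a = 0"
  shows "inner x y = (\<Sum>a\<in>I. coord x a * coord y a)"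
proof -
  have "inner x y = (\<Sum>a\<in>I \<union> {a. coord x a \<noteq> 0}. coord x a * coord y a)"
    unfolding inner_fvec_def using assms(1) by (intro sum.mono_neutral_left) auto
  also have "\<dots> = (\<Sum>a\<in>I. coord x a * coord y a)"
    using assms by (intro sum.mono_neutral_right) auto
  finally show ?thesis .
qed

instance
proof
  fix x y z :: "'a fvec" and r :: real
  let ?S = "\<lambda>x. {a. coord x a \<noteq> 0}"
  have "inner x y = (\<Sum>a\<in>?S y. coord x a * coord y a)"
    by (rule inner_fvec_superset) auto
  then show "inner x y = inner y x"
    by (simp add: inner_fvec_def mult.commute)
  show "inner (x + y) z = inner x z + inner y z"
  proof -
    have "inner (x + y) z = (\<Sum>a\<in>?S x \<union> ?S y \<union> ?S z. coord (x + y) a * coord z a)"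
      by (rule inner_fvec_superset) auto
    moreover have "inner x z = (\<Sum>a\<in>?S x \<union> ?S y \<union> ?S z. coord x a * coord z a)"
      by (rule inner_fvec_superset) auto
    moreover have "inner y z = (\<Sum>a\<in>?S x \<union> ?S y \<union> ?S z. coord y a * coord z a)"
      by (rule inner_fvec_superset) auto
    ultimately show ?thesis
      by (simp add: distrib_right sum.distrib)
  qed
  show "inner (r *\<^sub>R x) y = r * inner x y"
  proof -
    have "inner (r *\<^sub>R x) y = (\<Sum>a\<in>?S x. coord (r *\<^sub>R x) a * coord y a)"
      by (rule inner_fvec_superset) auto
    then show ?thesis
      by (simp add: inner_fvec_def sum_distrib_left mult.assoc)
  qed
  show "0 \<le> inner x x"
    unfolding inner_fvec_def by (intro sum_nonneg) auto
  show "(inner x x = 0) = (x = 0)"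
  proof
    assume "inner x x = 0"
    then have "\<forall>a\<in>?S x. coord x a * coord x a = 0"
      unfolding inner_fvec_def by (subst (asm) sum_nonneg_eq_0_iff) auto
    then show "x = 0" by (intro fvec_eqI) auto
  qed (simp add: inner_fvec_def)
qed (simp_all add: dist_fvec_def norm_fvec_def sgn_fvec_def uniformity_fvec_def open_fvec_def)

end

definition coord_space :: "'a set \<Rightarrow> 'a fvec set"
  where "coord_space I = {x. \<forall>a. a \<notin> I \<longrightarrow> coord x a = 0}"

abbreviation Rn :: "nat \<Rightarrow> nat fvec set"
  where "Rn d \<equiv> coord_space {..<d}"

lift_definition unit_vec :: "'a \<Rightarrow> 'a fvec" is "\<lambda>a b. if b = a then 1 else 0"
  by simp

lemma inner_coord_space:
  "finite I \<Longrightarrow> x \<in> coord_space I \<Longrightarrow> inner x y = (\<Sum>a\<in>I. coord x a * coord y a)"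
  by (rule inner_fvec_superset) (auto simp: coord_space_def)

lemma coord_unit_vec [simp]: "coord (unit_vec a) b = (if b = a then 1 else 0)"
  by transfer simp

lemma subspace_coord_space [simp]: "subspace (coord_space I)"
  by (auto simp: subspace_def coord_space_def)

lemma coord_space_expand:
  assumes "finite I" "x \<in> coord_space I"
  shows "x = (\<Sum>a\<in>I. coord x a *\<^sub>R unit_vec a)"
  using assms by (intro fvec_eqI) (auto simp: coord_space_def if_distrib sum.delta' cong: if_cong)


section \<open>Convex bodies, ellipsoids and the Hausdorff distance\<close>

text \<open>The argument \<open>V\<close> is always a coordinate space; it plays the role of the ambient space,
  and interiors are taken relative to it.\<close>

definition sym_convex_bodies :: "'a::real_inner set \<Rightarrow> 'a set set"
  where "sym_convex_bodies V =
    {P. P \<subseteq> V \<and> compact P \<and> convex P \<and> top_of_set V interior_of P \<noteq> {} \<and> uminus ` P = P}"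

definition polar :: "'a::real_inner set \<Rightarrow> 'a set \<Rightarrow> 'a set"
  where "polar V P = {y \<in> V. \<forall>x\<in>P. inner x y \<le> 1}"

definition unit_ball :: "'a::real_inner set \<Rightarrow> 'a set"
  where "unit_ball V = V \<inter> cball 0 1"

text \<open>An isomorphism of \<open>V\<close> is represented by any linear map extending it to the whole type;
  only its values on \<open>V\<close> matter.\<close>

definition GL :: "'a::real_inner set \<Rightarrow> ('a \<Rightarrow> 'a) set"
  where "GL V = {T. linear T \<and> bij_betw T V V}"

definition ellipsoids :: "'a::real_inner set \<Rightarrow> 'a set set"
  where "ellipsoids V = {T ` unit_ball V | T. T \<in> GL V}"

text \<open>The value \<open>0\<close> outside the nonempty bounded sets keeps the function nonnegative everywhere,
  which \<^locale>\<open>Metric_space\<close> demands even off its carrier.\<close>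

definition hausdorff_dist :: "'a::metric_space set \<Rightarrow> 'a set \<Rightarrow> real"
  where "hausdorff_dist A B =
    (if A \<noteq> {} \<and> B \<noteq> {} \<and> bounded A \<and> bounded B
     then max (SUP x\<in>A. infdist x B) (SUP y\<in>B. infdist y A) else 0)"

definition hausdorff_topology :: "'a::metric_space set set \<Rightarrow> 'a set topology"
  where "hausdorff_topology S = Metric_space.mtopology S hausdorff_dist"


section \<open>Tensor products\<close>

text \<open>The tensor product of \<open>Rn (d 0), \<dots>, Rn (d (l - 1))\<close> is the space of \<open>l\<close>-way arrays of
  format \<open>d 0 \<times> \<dots> \<times> d (l - 1)\<close>, with coordinates indexed by multi-indices.\<close>

definition multi_index :: "nat \<Rightarrow> (nat \<Rightarrow> nat) \<Rightarrow> (nat \<Rightarrow> nat) set"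
  where "multi_index l d = (\<Pi>\<^sub>E i\<in>{..<l}. {..<d i})"

abbreviation tensor_space :: "nat \<Rightarrow> (nat \<Rightarrow> nat) \<Rightarrow> (nat \<Rightarrow> nat) fvec set"
  where "tensor_space l d \<equiv> coord_space (multi_index l d)"

lemma finite_multi_index [simp]: "finite (multi_index l d)"
  by (simp add: multi_index_def finite_PiE)

lift_definition elem_tensor :: "nat \<Rightarrow> (nat \<Rightarrow> nat) \<Rightarrow> (nat \<Rightarrow> nat fvec) \<Rightarrow> (nat \<Rightarrow> nat) fvec"
  is "\<lambda>l d x k. if k \<in> multi_index l d then \<Prod>i<l. x i (k i) else 0"
  by (rule finite_subset[OF _ finite_multi_index]) auto

lemma coord_elem_tensor:
  "coord (elem_tensor l d x) k = (if k \<in> multi_index l d then \<Prod>i<l. coord (x i) (k i) else 0)"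
  by transfer simp

lemma elem_tensor_in_tensor_space: "elem_tensor l d x \<in> tensor_space l d"
  by (auto simp: coord_space_def coord_elem_tensor)

lemma inner_elem_tensor:
  assumes "\<And>i. i < l \<Longrightarrow> x i \<in> Rn (d i)"
  shows "inner (elem_tensor l d x) (elem_tensor l d y) = (\<Prod>i<l. inner (x i) (y i))"
proof -
  have "inner (elem_tensor l d x) (elem_tensor l d y) =
      (\<Sum>k\<in>multi_index l d. \<Prod>i<l. coord (x i) (k i) * coord (y i) (k i))"
    by (simp add: inner_coord_space[OF finite_multi_index elem_tensor_in_tensor_space]
        coord_elem_tensor prod.distrib)
  also have "\<dots> = (\<Prod>i<l. \<Sum>a<d i. coord (x i) a * coord (y i) a)"
    by (simp add: multi_index_def prod_sum_PiE)
  also have "\<dots> = (\<Prod>i<l. inner (x i) (y i))"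
    by (rule prod.cong) (simp_all add: inner_coord_space[OF finite_lessThan assms])
  finally show ?thesis .
qed

lemma unit_vec_multi_index:
  assumes "k \<in> multi_index l d"
  shows "unit_vec k = elem_tensor l d (\<lambda>i. unit_vec (k i))"
proof (rule fvec_eqI)
  fix j
  show "coord (unit_vec k) j = coord (elem_tensor l d (\<lambda>i. unit_vec (k i))) j"
  proof (cases "j \<in> multi_index l d")
    case False
    with assms have "j \<noteq> k" by blast
    with False show ?thesis by (simp add: coord_elem_tensor)
  next
    case True
    have "(\<Prod>i<l. coord (unit_vec (k i)) (j i)) = (if j = k then 1 else 0)"
    proof (cases "j = k")
      case False
      then obtain i where "i < l" "j i \<noteq> k i"
        using True assms PiE_ext[of j "{..<l}" "\<lambda>i. {..<d i}" k] by (auto simp: multi_index_def)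
      then have "\<exists>i\<in>{..<l}. coord (unit_vec (k i)) (j i) = 0"
        by (intro bexI[of _ i]) simp_all
      then show ?thesis
        using False by (simp add: prod_zero)
    qed simp
    then show ?thesis
      using True by (simp add: coord_elem_tensor)
  qed
qed

lemma tensor_space_eq_span:
  "tensor_space l d = span {elem_tensor l d x | x. \<forall>i<l. x i \<in> Rn (d i)}" (is "_ = span ?S")
proof
  show "span ?S \<subseteq> tensor_space l d"
    by (rule span_minimal) (auto simp: elem_tensor_in_tensor_space)
  show "tensor_space l d \<subseteq> span ?S"
  proof
    fix z assume z: "z \<in> tensor_space l d"
    have "unit_vec k \<in> span ?S" if k: "k \<in> multi_index l d" for k
    proof -
      have "\<forall>i<l. unit_vec (k i) \<in> Rn (d i)"
        using k by (auto simp: coord_space_def multi_index_def PiE_iff)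
      then show ?thesis
        unfolding unit_vec_multi_index[OF k]
        by (intro span_base CollectI exI[of _ "\<lambda>i. unit_vec (k i)"] conjI refl)
    qed
    then have "(\<Sum>k\<in>multi_index l d. coord z k *\<^sub>R unit_vec k) \<in> span ?S"
      by (intro span_sum span_scale)
    then show "z \<in> span ?S"
      using coord_space_expand[OF finite_multi_index z] by simp
  qed
qed

definition tensor_map ::
  "nat \<Rightarrow> (nat \<Rightarrow> nat) \<Rightarrow> (nat \<Rightarrow> nat fvec \<Rightarrow> nat fvec) \<Rightarrow> (nat \<Rightarrow> nat) fvec \<Rightarrow> (nat \<Rightarrow> nat) fvec"
  where "tensor_map l d T z =
    (\<Sum>k\<in>multi_index l d. coord z k *\<^sub>R elem_tensor l d (\<lambda>i. T i (unit_vec (k i))))"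

lemma linear_tensor_map: "linear (tensor_map l d T)"
  by (rule linearI) (simp_all add: tensor_map_def scaleR_add_left sum.distrib scaleR_sum_right)

lemma tensor_map_elem_tensor:
  assumes "\<And>i. i < l \<Longrightarrow> linear (T i)" "\<And>i. i < l \<Longrightarrow> x i \<in> Rn (d i)"
  shows "tensor_map l d T (elem_tensor l d x) = elem_tensor l d (\<lambda>i. T i (x i))"
proof (rule fvec_eqI)
  fix k
  have *: "coord (T i (x i)) b = (\<Sum>a<d i. coord (x i) a * coord (T i (unit_vec a)) b)"
    if "i < l" for i b
    by (subst coord_space_expand[OF _ assms(2)[OF that]])
       (simp_all add: linear_sum[OF assms(1)[OF that]] linear_scale[OF assms(1)[OF that]])
  show "coord (tensor_map l d T (elem_tensor l d x)) k = coord (elem_tensor l d (\<lambda>i. T i (x i))) k"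
  proof (cases "k \<in> multi_index l d")
    case True
    then have "coord (tensor_map l d T (elem_tensor l d x)) k = (\<Sum>j\<in>multi_index l d.
        \<Prod>i<l. coord (x i) (j i) * coord (T i (unit_vec (j i))) (k i))"
      by (simp add: tensor_map_def coord_elem_tensor prod.distrib)
    also have "\<dots> = (\<Prod>i<l. \<Sum>a<d i. coord (x i) a * coord (T i (unit_vec a)) (k i))"
      by (simp add: multi_index_def prod_sum_PiE)
    finally show ?thesis
      using True by (simp add: coord_elem_tensor *)
  qed (simp add: tensor_map_def coord_elem_tensor)
qed

text \<open>The chosen isomorphisms \<open>T i\<close> are arbitrary; see \<open>hilbert_tensor_eq\<close> for independence.\<close>

definition hilbert_tensor ::
  "nat \<Rightarrow> (nat \<Rightarrow> nat) \<Rightarrow> (nat \<Rightarrow> nat fvec set) \<Rightarrow> (nat \<Rightarrow> nat) fvec set"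
  where "hilbert_tensor l d E =
    tensor_map l d (\<lambda>i. SOME T. T \<in> GL (Rn (d i)) \<and> E i = T ` unit_ball (Rn (d i)))
      ` unit_ball (tensor_space l d)"

definition proj_tensor ::
  "nat \<Rightarrow> (nat \<Rightarrow> nat) \<Rightarrow> (nat \<Rightarrow> nat fvec set) \<Rightarrow> (nat \<Rightarrow> nat) fvec set"
  where "proj_tensor l d P = convex hull {elem_tensor l d x | x. \<forall>i<l. x i \<in> P i}"

definition inj_tensor ::
  "nat \<Rightarrow> (nat \<Rightarrow> nat) \<Rightarrow> (nat \<Rightarrow> nat fvec set) \<Rightarrow> (nat \<Rightarrow> nat) fvec set"
  where "inj_tensor l d P =
    polar (tensor_space l d) (proj_tensor l d (\<lambda>i. polar (Rn (d i)) (P i)))"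

definition tensorial_body :: "nat \<Rightarrow> (nat \<Rightarrow> nat) \<Rightarrow> (nat \<Rightarrow> nat) fvec set \<Rightarrow> bool"
  where "tensorial_body l d Q \<longleftrightarrow> Q \<in> sym_convex_bodies (tensor_space l d) \<and>
    (\<exists>P. (\<forall>i<l. P i \<in> sym_convex_bodies (Rn (d i))) \<and>
         proj_tensor l d P \<subseteq> Q \<and> Q \<subseteq> inj_tensor l d P)"

definition tensorial_ellipsoids :: "nat \<Rightarrow> (nat \<Rightarrow> nat) \<Rightarrow> (nat \<Rightarrow> nat) fvec set set"
  where "tensorial_ellipsoids l d = {Q \<in> ellipsoids (tensor_space l d). tensorial_body l d Q}"


section \<open>Well-definedness\<close>

lemma norm_eq_if_unit_ball_image_eq:
  fixes S T :: "'a fvec \<Rightarrow> 'a fvec"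
  assumes S: "S \<in> GL V" and T: "T \<in> GL V" and V: "subspace V"
    and eq: "T ` unit_ball V = S ` unit_ball V"
    and xy: "x \<in> V" "y \<in> V" "T x = S y"
  shows "norm x = norm y"
proof -
  have le: "norm y \<le> norm x"
    if S: "S \<in> GL V" and T: "T \<in> GL V" and eq: "T ` unit_ball V = S ` unit_ball V"
      and xy: "x \<in> V" "y \<in> V" "T x = S y" for S T :: "'a fvec \<Rightarrow> 'a fvec" and x y
  proof -
    have lS: "linear S" and lT: "linear T" and inj: "inj_on S V"
      using S T by (simp_all add: GL_def bij_betw_def)
    show ?thesis
    proof (cases "x = 0")
      case True
      then have "S y = S 0"
        using xy(3) linear_0[OF lS] linear_0[OF lT] by simp
      then have "y = 0"
        using inj_onD[OF inj _ xy(2) subspace_0[OF V]] by blast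
      then show ?thesis by simp
    next
      case False
      let ?c = "inverse (norm x)"
      have "?c *\<^sub>R x \<in> unit_ball V"
        using False subspace_scale[OF V xy(1)] by (simp add: unit_ball_def)
      then have "T (?c *\<^sub>R x) \<in> S ` unit_ball V"
        using eq by blast
      then obtain w where w: "w \<in> unit_ball V" "T (?c *\<^sub>R x) = S w" by blast
      have "S (?c *\<^sub>R y) = S w"
        using w(2) xy(3) by (simp only: linear_scale[OF lS] linear_scale[OF lT])
      then have "?c *\<^sub>R y = w"
        using inj_onD[OF inj _ subspace_scale[OF V xy(2)]] w(1) by (simp add: unit_ball_def)
      then have "norm (?c *\<^sub>R y) \<le> 1"
        using w(1) by (simp add: unit_ball_def)
      then show ?thesis
        using False by (simp add: field_simps)
    qed
  qed
  show ?thesis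
    using le[OF S T eq xy] le[OF T S eq[symmetric] xy(2,1) xy(3)[symmetric]] by simp
qed

lemma tensor_map_image_subset:
  assumes S: "\<And>i. i < l \<Longrightarrow> S i \<in> GL (Rn (d i))" and T: "\<And>i. i < l \<Longrightarrow> T i \<in> GL (Rn (d i))"
    and eq: "\<And>i. i < l \<Longrightarrow> T i ` unit_ball (Rn (d i)) = S i ` unit_ball (Rn (d i))"
  shows "tensor_map l d T ` unit_ball (tensor_space l d)
    \<subseteq> tensor_map l d S ` unit_ball (tensor_space l d)"
proof -
  define u where "u i a = inv_into (Rn (d i)) (S i) (T i (unit_vec a))" for i a
  define U where "U i x = (\<Sum>a<d i. coord x a *\<^sub>R u i a)" for i x
  have unitV: "unit_vec a \<in> Rn n" if "a < n" for a n
    using that by (auto simp: coord_space_def)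
  have u: "u i a \<in> Rn (d i)" "S i (u i a) = T i (unit_vec a)" if "i < l" "a < d i" for i a
  proof -
    have "bij_betw (S i) (Rn (d i)) (Rn (d i))" "bij_betw (T i) (Rn (d i)) (Rn (d i))"
      using S[OF that(1)] T[OF that(1)] by (simp_all add: GL_def)
    then have "T i (unit_vec a) \<in> S i ` Rn (d i)"
      using bij_betw_apply unitV[OF that(2)] by (metis bij_betw_imp_surj_on)
    then show "u i a \<in> Rn (d i)" "S i (u i a) = T i (unit_vec a)"
      unfolding u_def by (simp_all add: inv_into_into f_inv_into_f)
  qed
  have linU: "linear (U i)" for i
    by (rule linearI) (simp_all add: U_def scaleR_add_left sum.distrib scaleR_sum_right)
  have UV: "U i x \<in> Rn (d i)" if "i < l" for i x
    unfolding U_def using u(1)[OF that] by (auto intro!: subspace_sum subspace_scale)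
  have SU: "S i (U i x) = T i x" if "i < l" "x \<in> Rn (d i)" for i x
  proof -
    have lS: "linear (S i)" and lT: "linear (T i)"
      using S[OF that(1)] T[OF that(1)] by (simp_all add: GL_def)
    have "S i (U i x) = (\<Sum>a<d i. coord x a *\<^sub>R T i (unit_vec a))"
      unfolding U_def using u(2)[OF that(1)] by (simp add: linear_sum[OF lS] linear_scale[OF lS])
    also have "\<dots> = T i (\<Sum>a<d i. coord x a *\<^sub>R unit_vec a)"
      by (simp add: linear_sum[OF lT] linear_scale[OF lT])
    finally show ?thesis
      using coord_space_expand[OF _ that(2)] by simp
  qed
  have normU: "norm (U i x) = norm x" if "i < l" "x \<in> Rn (d i)" for i x
    using norm_eq_if_unit_ball_image_eq[OF S[OF that(1)] T[OF that(1)] subspace_coord_space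
        eq[OF that(1)] that(2) UV[OF that(1)] SU[OF that, symmetric]] by simp
  have innerU: "inner (U i x) (U i y) = inner x y" if "i < l" "x \<in> Rn (d i)" "y \<in> Rn (d i)" for i x y
    unfolding dot_norm linear_add[OF linU, symmetric]
    by (simp only: normU[OF that(1)] that subspace_add[OF subspace_coord_space])
  have basis: "inner (elem_tensor l d (\<lambda>i. U i (unit_vec (j i))))
      (elem_tensor l d (\<lambda>i. U i (unit_vec (k i)))) = inner (unit_vec j) (unit_vec k)"
    if "j \<in> multi_index l d" "k \<in> multi_index l d" for j k
  proof -
    have lt: "j i < d i" "k i < d i" if "i < l" for i
      using that \<open>j \<in> _\<close> \<open>k \<in> _\<close> by (auto simp: multi_index_def PiE_iff)
    have "inner (elem_tensor l d (\<lambda>i. U i (unit_vec (j i))))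
        (elem_tensor l d (\<lambda>i. U i (unit_vec (k i)))) = (\<Prod>i<l. inner (U i (unit_vec (j i))) (U i (unit_vec (k i))))"
      by (rule inner_elem_tensor) (rule UV)
    also have "\<dots> = (\<Prod>i<l. inner (unit_vec (j i)) (unit_vec (k i)))"
      by (rule prod.cong) (simp_all add: innerU unitV lt)
    also have "\<dots> = inner (unit_vec j) (unit_vec k)"
      unfolding unit_vec_multi_index[OF that(1)] unit_vec_multi_index[OF that(2)]
      by (rule inner_elem_tensor[symmetric]) (simp add: unitV lt)
    finally show ?thesis .
  qed
  have "tensor_map l d T z \<in> tensor_map l d S ` unit_ball (tensor_space l d)"
    if z: "z \<in> unit_ball (tensor_space l d)" for z
  proof
    let ?w = "tensor_map l d U z"
    have zs: "z = (\<Sum>k\<in>multi_index l d. coord z k *\<^sub>R unit_vec k)"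
      using coord_space_expand[OF finite_multi_index, of z] z by (simp add: unit_ball_def)
    have "inner ?w ?w = inner z z"
      by (subst (3 4) zs) (simp add: tensor_map_def inner_sum_left inner_sum_right basis)
    then have "norm ?w = norm z"
      by (simp add: norm_eq_sqrt_inner)
    moreover have "?w \<in> tensor_space l d"
      unfolding tensor_map_def
      by (auto intro!: subspace_sum subspace_scale simp: elem_tensor_in_tensor_space)
    ultimately show "?w \<in> unit_ball (tensor_space l d)"
      using z by (simp add: unit_ball_def)
    have "tensor_map l d S (elem_tensor l d (\<lambda>i. U i (unit_vec (k i)))) =
        elem_tensor l d (\<lambda>i. T i (unit_vec (k i)))" if k: "k \<in> multi_index l d" for k
    proof -
      have lt: "k i < d i" if "i < l" for i
        using that k by (auto simp: multi_index_def PiE_iff)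
      have "tensor_map l d S (elem_tensor l d (\<lambda>i. U i (unit_vec (k i)))) =
          elem_tensor l d (\<lambda>i. S i (U i (unit_vec (k i))))"
        by (rule tensor_map_elem_tensor) (use S in \<open>simp add: GL_def\<close>, rule UV)
      also have "\<dots> = elem_tensor l d (\<lambda>i. T i (unit_vec (k i)))"
        by (rule fvec_eqI) (simp add: coord_elem_tensor SU unitV lt)
      finally show ?thesis .
    qed
    then show "tensor_map l d T z = tensor_map l d S ?w"
      unfolding tensor_map_def[of l d U]
      by (simp add: linear_sum[OF linear_tensor_map] linear_scale[OF linear_tensor_map])
         (simp add: tensor_map_def)
  qed
  then show ?thesis by blast
qed

lemma hilbert_tensor_eq:
  assumes T: "\<And>i. i < l \<Longrightarrow> T i \<in> GL (Rn (d i))"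
    and E: "\<And>i. i < l \<Longrightarrow> E i = T i ` unit_ball (Rn (d i))"
  shows "hilbert_tensor l d E = tensor_map l d T ` unit_ball (tensor_space l d)"
proof -
  define S where "S i = (SOME T. T \<in> GL (Rn (d i)) \<and> E i = T ` unit_ball (Rn (d i)))" for i
  have S: "S i \<in> GL (Rn (d i)) \<and> E i = S i ` unit_ball (Rn (d i))" if "i < l" for i
    unfolding S_def by (rule someI[of _ "T i"]) (use T E that in auto)
  have "tensor_map l d S ` unit_ball (tensor_space l d)
      = tensor_map l d T ` unit_ball (tensor_space l d)"
    by (intro equalityI tensor_map_image_subset) (use S T E in auto)
  then show ?thesis
    unfolding hilbert_tensor_def S_def[abs_def] .
qed

lemma hausdorff_dist_le_iff:
  fixes A B :: "'a::metric_space set"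
  assumes "bounded A" "bounded B" "A \<noteq> {}" "B \<noteq> {}"
  shows "hausdorff_dist A B \<le> e \<longleftrightarrow> (\<forall>x\<in>A. infdist x B \<le> e) \<and> (\<forall>y\<in>B. infdist y A \<le> e)"
proof -
  have bdd: "bdd_above ((\<lambda>x. infdist x B) ` A)" if A: "bounded A" and B: "B \<noteq> {}" for A B :: "'a set"
  proof -
    obtain b where b: "b \<in> B" using B by blast
    obtain e where e: "\<forall>x\<in>A. dist b x \<le> e" using A by (metis bounded_any_center)
    have "infdist x B \<le> e" if "x \<in> A" for x
      using infdist_le[OF b, of x] e that by (force simp: dist_commute)
    then show ?thesis by (rule bdd_aboveI2)
  qed
  show ?thesis
    using assms by (simp add: hausdorff_dist_def cSUP_le_iff bdd)
qed

lemma Metric_space_hausdorff_dist: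
  "Metric_space {K :: 'a::metric_space set. compact K \<and> K \<noteq> {}} hausdorff_dist"
proof
  fix A B :: "'a set"
  show "hausdorff_dist A B = hausdorff_dist B A"
    by (auto simp: hausdorff_dist_def max.commute)
  have le: "infdist x B \<le> hausdorff_dist A B"
    if "bounded A" "bounded B" "B \<noteq> {}" "x \<in> A" for A B :: "'a set" and x
    using hausdorff_dist_le_iff[of A B "hausdorff_dist A B"] that by auto
  show nonneg: "0 \<le> hausdorff_dist A B" for A B :: "'a set"
  proof (cases "A \<noteq> {} \<and> B \<noteq> {} \<and> bounded A \<and> bounded B")
    case True
    then show ?thesis
      using le[of A B] infdist_nonneg order_trans by (metis ex_in_conv)
  qed (auto simp: hausdorff_dist_def)
  assume A: "A \<in> {K. compact K \<and> K \<noteq> {}}" and B: "B \<in> {K. compact K \<and> K \<noteq> {}}"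
  have mem: "x \<in> B" if "infdist x B \<le> 0" "compact B" "B \<noteq> {}" for x and B :: "'a set"
    using that in_closed_iff_infdist_zero[of B x] infdist_nonneg[of x B]
    by (auto simp: compact_imp_closed)
  have "hausdorff_dist A B \<le> 0 \<longleftrightarrow> A = B"
  proof -
    have "hausdorff_dist A B \<le> 0 \<longleftrightarrow> (\<forall>x\<in>A. infdist x B \<le> 0) \<and> (\<forall>y\<in>B. infdist y A \<le> 0)"
      using A B by (intro hausdorff_dist_le_iff) (simp_all add: compact_imp_bounded)
    also have "\<dots> \<longleftrightarrow> A = B"
    proof
      assume "(\<forall>x\<in>A. infdist x B \<le> 0) \<and> (\<forall>y\<in>B. infdist y A \<le> 0)"
      then show "A = B" using A B mem by blast
    qed auto
    finally show ?thesis .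
  qed
  then show "(hausdorff_dist A B = 0) = (A = B)"
    using nonneg[of A B] by simp
  fix C :: "'a set" assume C: "C \<in> {K. compact K \<and> K \<noteq> {}}"
  have *: "infdist x C \<le> hausdorff_dist A B + hausdorff_dist B C"
    if x: "x \<in> A" and "compact A" "compact B" "B \<noteq> {}" "compact C" "C \<noteq> {}"
    for x and A B C :: "'a set"
  proof -
    have "\<exists>y\<in>B. \<forall>z\<in>B. dist x y \<le> dist x z"
      using \<open>compact B\<close> \<open>B \<noteq> {}\<close>
      by (intro continuous_attains_inf continuous_on_dist continuous_on_const continuous_on_id)
    then obtain y where y: "y \<in> B" "\<And>z. z \<in> B \<Longrightarrow> dist x y \<le> dist x z"
      by blast
    have xy: "dist x y \<le> infdist x B"
      using \<open>B \<noteq> {}\<close> y(2) by (simp add: infdist_notempty cINF_greatest)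
    have "infdist x C \<le> infdist y C + dist x y"
      by (rule infdist_triangle)
    also have "\<dots> \<le> hausdorff_dist B C + hausdorff_dist A B"
      using le[of B C y] le[of A B x] that y(1) xy by (simp add: compact_imp_bounded)
    finally show ?thesis by simp
  qed
  have comm: "hausdorff_dist A B = hausdorff_dist B A" for A B :: "'a set"
    by (auto simp: hausdorff_dist_def max.commute)
  have "infdist x C \<le> hausdorff_dist A B + hausdorff_dist B C" if "x \<in> A" for x
    using A B C that by (intro *) auto
  moreover have "infdist x A \<le> hausdorff_dist A B + hausdorff_dist B C" if "x \<in> C" for x
    using *[of x C B A] A B C that by (simp add: comm[of C B] comm[of B A])
  ultimately show "hausdorff_dist A C \<le> hausdorff_dist A B + hausdorff_dist B C"
    using A C hausdorff_dist_le_iff[of A C] by (simp add: compact_imp_bounded)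
qed

lemma compact_unit_ball:
  assumes "finite I"
  shows "compact (unit_ball (coord_space I))"
proof -
  have coord_inner: "coord x a = inner (unit_vec a) x" for x :: "'a fvec" and a
    using inner_coord_space[of "{a}" "unit_vec a" x] by (simp add: coord_space_def)
  define box where "box J = {\<Sum>a\<in>J. c a *\<^sub>R unit_vec a | c. \<forall>a\<in>J. \<bar>c a\<bar> \<le> 1}" for J :: "'a set"
  have "compact (box J)" if "finite J" for J
    using that
  proof induction
    case empty
    have "box {} = {0}" by (auto simp: box_def)
    then show ?case by simp
  next
    case (insert b J)
    have "box (insert b J) = {x + y | x y. x \<in> (\<lambda>t. t *\<^sub>R unit_vec b) ` {-1..1} \<and> y \<in> box J}"
      (is "_ = ?R")
    proof
      show "box (insert b J) \<subseteq> ?R"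
      proof
        fix z assume "z \<in> box (insert b J)"
        then obtain c where c: "z = (\<Sum>a\<in>insert b J. c a *\<^sub>R unit_vec a)"
            "\<forall>a\<in>insert b J. \<bar>c a\<bar> \<le> 1"
          unfolding box_def by blast
        have "z = c b *\<^sub>R unit_vec b + (\<Sum>a\<in>J. c a *\<^sub>R unit_vec a)"
          using c(1) insert.hyps by simp
        moreover have "c b *\<^sub>R unit_vec b \<in> (\<lambda>t. t *\<^sub>R unit_vec b) ` {-1..1}"
          using c(2) by (intro imageI) auto
        moreover have "(\<Sum>a\<in>J. c a *\<^sub>R unit_vec a) \<in> box J"
          using c(2) unfolding box_def by blast
        ultimately show "z \<in> ?R" by blast
      qed
      show "?R \<subseteq> box (insert b J)"
      proof
        fix z assume "z \<in> ?R"
        then obtain t c where c: "z = t *\<^sub>R unit_vec b + (\<Sum>a\<in>J. c a *\<^sub>R unit_vec a)"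
            "t \<in> {-1..1}" "\<forall>a\<in>J. \<bar>c a\<bar> \<le> 1"
          unfolding box_def by blast
        have "(\<Sum>a\<in>J. (c(b := t)) a *\<^sub>R unit_vec a) = (\<Sum>a\<in>J. c a *\<^sub>R unit_vec a)"
          using insert.hyps by (intro sum.cong) auto
        then have "z = (\<Sum>a\<in>insert b J. (c(b := t)) a *\<^sub>R unit_vec a)"
          using c(1) insert.hyps by simp
        moreover have "\<forall>a\<in>insert b J. \<bar>(c(b := t)) a\<bar> \<le> 1"
          using c(2,3) by auto
        ultimately show "z \<in> box (insert b J)"
          unfolding box_def by blast
      qed
    qed
    moreover have "compact ((\<lambda>t. t *\<^sub>R unit_vec b) ` {-1..1::real})"
      by (intro compact_continuous_image continuous_on_scaleR continuous_on_id continuous_on_const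
          compact_Icc)
    then have "compact ?R"
      by (rule compact_sums) (rule insert.IH)
    ultimately show ?case by (simp only:)
  qed
  then have "compact (box I)" using assms by blast
  moreover have "unit_ball (coord_space I) \<subseteq> box I"
  proof
    fix x assume x: "x \<in> unit_ball (coord_space I)"
    have "\<bar>coord x a\<bar> \<le> 1" for a
    proof -
      have "norm (unit_vec a) = 1"
        using coord_inner[of "unit_vec a" a] by (simp add: norm_eq_sqrt_inner)
      then show ?thesis
        using Cauchy_Schwarz_ineq2[of "unit_vec a" x] x by (simp add: coord_inner unit_ball_def)
    qed
    then show "x \<in> box I"
      using coord_space_expand[OF assms, of x] x unfolding box_def unit_ball_def by blast
  qed
  moreover have "closed (unit_ball (coord_space I))"
  proof -
    have "coord_space I = (\<Inter>a\<in>-I. {x. inner (unit_vec a) x = 0})"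
      by (auto simp: coord_space_def coord_inner)
    then show ?thesis
      unfolding unit_ball_def by (auto intro!: closed_Int closed_INT closed_hyperplane)
  qed
  ultimately show ?thesis
    using compact_Int_closed[of "box I" "unit_ball (coord_space I)"] by (simp only: inf.absorb2)
qed

lemma compact_ellipsoid:
  assumes I: "finite I" and E: "E \<in> ellipsoids (coord_space I)"
  shows "compact E \<and> E \<noteq> {}"
proof -
  obtain T where T: "linear T" "E = T ` unit_ball (coord_space I)"
    using E by (auto simp: ellipsoids_def GL_def)
  have coord_inner: "coord x a = inner (unit_vec a) x" for x :: "'a fvec" and a
    using inner_coord_space[of "{a}" "unit_vec a" x] by (simp add: coord_space_def)
  have "T x = (\<Sum>a\<in>I. inner (unit_vec a) x *\<^sub>R T (unit_vec a))" if "x \<in> unit_ball (coord_space I)" for x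
  proof -
    have "T x = T (\<Sum>a\<in>I. coord x a *\<^sub>R unit_vec a)"
      using coord_space_expand[OF I, of x] that by (simp add: unit_ball_def)
    then show ?thesis
      by (simp add: linear_sum[OF T(1)] linear_scale[OF T(1)] coord_inner)
  qed
  then have "E = (\<lambda>x. \<Sum>a\<in>I. inner (unit_vec a) x *\<^sub>R T (unit_vec a)) ` unit_ball (coord_space I)"
    using T(2) by (simp cong: image_cong)
  moreover have "compact \<dots>"
    by (intro compact_continuous_image compact_unit_ball[OF I] continuous_on_sum
        continuous_on_scaleR continuous_on_inner continuous_on_const continuous_on_id)
  moreover have "0 \<in> unit_ball (coord_space I)"
    by (simp add: unit_ball_def subspace_0)
  ultimately show ?thesis
    using T(2) by auto
qed

lemma Metric_space_ellipsoids:
  "Metric_space (ellipsoids (Rn n)) hausdorff_dist"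
  "Metric_space (tensorial_ellipsoids l d) hausdorff_dist"
  using compact_ellipsoid[of "{..<n}"] compact_ellipsoid[of "multi_index l d"]
  by (auto simp: tensorial_ellipsoids_def intro!: Metric_space.subspace[OF Metric_space_hausdorff_dist])

end

theory Submission
  imports Defs
begin

text \<open>
  Write \<open>E = T(B)\<close> and \<open>E' = T'(B)\<close>.  If \<open>E\<close> contains the ball of radius \<open>r\<close> and the Hausdorff
  distance of \<open>E\<close> and \<open>E'\<close> is less than \<open>\<lambda> r\<close> with \<open>\<lambda> < 1\<close>, then
  \<open>(1 - \<lambda>) E \<subseteq> E' \<subseteq> (1 + \<lambda>) E\<close>, that is, \<open>T'\<^sup>-\<^sup>1 T\<close> and \<open>T\<^sup>-\<^sup>1 T'\<close> have operator norms at most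
  \<open>1 / (1 - \<lambda>)\<close> and \<open>1 + \<lambda>\<close>.  Operator norms of tensor products of maps are bounded by the products
  of the operator norms, so the Hilbertian tensor products satisfy
  \<open>(1 - \<lambda>)\<^sup>l Q \<subseteq> Q' \<subseteq> (1 + \<lambda>)\<^sup>l Q\<close>.  As \<open>Q\<close> is bounded, \<open>Q'\<close> is close to \<open>Q\<close> for small \<open>\<lambda>\<close>.
\<close>

section \<open>Linear maps between coordinate spaces\<close>

text \<open>The inverse is recorded as a linear map on the whole type, which \<open>inv_into\<close>
  would not provide. Compositions such as \<open>S' (T x)\<close> are then linear everywhere and
  have operator norms on \<open>V\<close>.\<close>

definition inverse_on :: "'a::real_vector set \<Rightarrow> ('a \<Rightarrow> 'a) \<Rightarrow> ('a \<Rightarrow> 'a) \<Rightarrow> bool"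
  where "inverse_on V T S \<longleftrightarrow> linear T \<and> linear S \<and>
    (\<forall>x\<in>V. T x \<in> V \<and> S x \<in> V \<and> S (T x) = x \<and> T (S x) = x)"

lemma inverse_onD:
  assumes "inverse_on V T S"
  shows "linear T" "linear S"
    "x \<in> V \<Longrightarrow> T x \<in> V" "x \<in> V \<Longrightarrow> S x \<in> V"
    "x \<in> V \<Longrightarrow> S (T x) = x" "x \<in> V \<Longrightarrow> T (S x) = x"
  using assms by (auto simp: inverse_on_def)

lemma GL_iff_inverse_on:
  assumes "subspace V"
  shows "T \<in> GL V \<longleftrightarrow> (\<exists>S. inverse_on V T S)"
proof
  assume "T \<in> GL V"
  then have T: "linear T" "inj_on T V" "T ` V = V"
    by (auto simp: GL_def bij_betw_def)
  obtain S where S: "range S \<subseteq> V" "linear S" "\<And>v. v \<in> V \<Longrightarrow> S (T v) = v"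
    using linear_exists_left_inverse_on[OF T(1) assms T(2)] by blast
  have "T (S x) = x" if "x \<in> V" for x
    using T(3) S(3) that by (metis imageE)
  then show "\<exists>S. inverse_on V T S"
    using T S unfolding inverse_on_def by blast
next
  assume "\<exists>S. inverse_on V T S"
  then obtain S where S: "inverse_on V T S" ..
  have "bij_betw T V V"
    by (rule bij_betw_byWitness[of _ S]) (auto simp: inverse_onD[OF S])
  then show "T \<in> GL V"
    using inverse_onD(1)[OF S] by (simp add: GL_def)
qed

lemma unit_vec_in_coord_space [simp]: "unit_vec a \<in> coord_space I \<longleftrightarrow> a \<in> I"
  by (auto simp: coord_space_def)

lemma inner_unit_vec_left [simp]: "inner (unit_vec a) x = coord x a"
  using inner_coord_space[of "{a}" "unit_vec a" x] by simp

lemma norm_unit_vec [simp]: "norm (unit_vec a) = 1"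
  by (simp add: norm_eq_sqrt_inner)

lemma abs_coord_le_norm: "\<bar>coord x a\<bar> \<le> norm x"
  using Cauchy_Schwarz_ineq2[of "unit_vec a" x] by simp

text \<open>Expansion in the finitely many unit vectors of \<open>I\<close> gives the bound. It is
  confined to \<open>coord_space I\<close> because the whole type can have infinite dimension, where
  linear maps may be unbounded.\<close>

lemma linear_bounded_on_coord_space:
  fixes f :: "'a fvec \<Rightarrow> 'b::real_normed_vector"
  assumes "finite I" "linear f"
  obtains K where "K > 0" "\<And>x. x \<in> coord_space I \<Longrightarrow> norm (f x) \<le> K * norm x"
proof
  \<comment> \<open>The summand \<open>1\<close> keeps the constant positive when \<open>f\<close>
    vanishes on all unit vectors, so that its reciprocal can serve as a radius.\<close>
  let ?K = "(\<Sum>a\<in>I. norm (f (unit_vec a))) + 1"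
  show "?K > 0"
    by (smt (verit) norm_ge_zero sum_nonneg)
  fix x :: "'a fvec" assume x: "x \<in> coord_space I"
  have "f x = (\<Sum>a\<in>I. coord x a *\<^sub>R f (unit_vec a))"
    by (subst coord_space_expand[OF assms(1) x])
       (simp add: linear_sum[OF assms(2)] linear_scale[OF assms(2)])
  also have "norm \<dots> \<le> (\<Sum>a\<in>I. norm x * norm (f (unit_vec a)))"
    by (intro sum_norm_le) (simp add: mult_right_mono abs_coord_le_norm)
  also have "\<dots> \<le> ?K * norm x"
    by (simp add: algebra_simps flip: sum_distrib_left)
  finally show "norm (f x) \<le> ?K * norm x" .
qed

lemma norm_linear_le_scaled:
  fixes f :: "'a::real_inner \<Rightarrow> 'b::real_normed_vector"
  assumes "linear f" "subspace V" "\<And>x. x \<in> unit_ball V \<Longrightarrow> norm (f x) \<le> c" "x \<in> V"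
  shows "norm (f x) \<le> c * norm x"
proof (cases "x = 0")
  case True
  then show ?thesis using linear_0[OF assms(1)] by simp
next
  case False
  have "inverse (norm x) *\<^sub>R x \<in> unit_ball V"
    using False assms(2,4) by (simp add: unit_ball_def subspace_scale)
  from assms(3)[OF this] show ?thesis
    using False by (simp add: linear_scale[OF assms(1)] field_simps)
qed

lemma subspace_imp_zero_in_unit_ball: "subspace V \<Longrightarrow> 0 \<in> unit_ball V"
  by (simp add: unit_ball_def subspace_0)

text \<open>On \<open>V\<close> the gauge of the ellipsoid is \<open>norm (S x)\<close>, which turns
  inclusions of ellipsoids into operator norm bounds.\<close>

lemma mem_linear_image_unit_ball:
  assumes "inverse_on V T S" "x \<in> V" "norm (S x) \<le> 1"
  shows "x \<in> T ` unit_ball V"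
  using inverse_onD[OF assms(1)] assms(2,3)
  by (intro image_eqI[of _ _ "S x"]) (auto simp: unit_ball_def)


section \<open>Ellipsoids\<close>

lemma ellipsoid_sym_convex_body:
  fixes E :: "'a fvec set"
  assumes I: "finite I" and E: "E \<in> ellipsoids (coord_space I)"
  shows "E \<in> sym_convex_bodies (coord_space I)"
proof -
  let ?V = "coord_space I"
  obtain T S where TS: "inverse_on ?V T S" and ET: "E = T ` unit_ball ?V"
    using E by (auto simp: ellipsoids_def GL_iff_inverse_on)
  note lT = inverse_onD(1)[OF TS]
  have EV: "E \<subseteq> ?V"
    using inverse_onD(3)[OF TS] by (auto simp: ET unit_ball_def)
  have "convex (unit_ball ?V)"
    unfolding unit_ball_def by (intro convex_Int subspace_imp_convex convex_cball) simp
  then have convex: "convex E"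
    unfolding ET by (rule convex_linear_image[OF lT])
  have "uminus ` unit_ball ?V = unit_ball ?V"
    by (force simp: unit_ball_def subspace_neg image_iff intro: bexI[of _ "- x" for x])
  then have sym: "uminus ` E = E"
    unfolding ET image_image linear_neg[OF lT, symmetric] by (metis image_image)
  obtain K where K: "K > 0" "\<And>x. x \<in> ?V \<Longrightarrow> norm (S x) \<le> K * norm x"
    using linear_bounded_on_coord_space[OF I inverse_onD(2)[OF TS]] by blast
  \<comment> \<open>A bound \<open>K\<close> for the inverse map yields a relative ball of radius
    \<open>1 / K\<close> inside the ellipsoid, hence interior points.\<close>
  have "ball 0 (1 / K) \<inter> ?V \<subseteq> E"
  proof
    fix x assume x: "x \<in> ball 0 (1 / K) \<inter> ?V"
    then have "K * norm x \<le> 1"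
      using K(1) by (simp add: field_simps)
    then have "norm (S x) \<le> 1"
      using K(2)[of x] x by simp
    then show "x \<in> E"
      unfolding ET using mem_linear_image_unit_ball[OF TS] x by blast
  qed
  moreover have "openin (top_of_set ?V) (ball 0 (1 / K) \<inter> ?V)"
    by (simp add: openin_open_Int Int_commute)
  moreover have "0 \<in> ball 0 (1 / K) \<inter> ?V"
    using K(1) by (simp add: subspace_0)
  ultimately have "top_of_set ?V interior_of E \<noteq> {}"
    unfolding interior_of_def by blast
  then show ?thesis
    using EV compact_ellipsoid[OF I E] convex sym by (simp add: sym_convex_bodies_def)
qed

section \<open>Ellipsoids that are close in the Hausdorff distance\<close>

lemma hausdorff_dist_lessD:
  fixes A B :: "'a::metric_space set"
  assumes "hausdorff_dist A B < e" "bounded A" "bounded B" "A \<noteq> {}" "B \<noteq> {}"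
  shows "x \<in> A \<Longrightarrow> \<exists>y\<in>B. dist x y < e" "y \<in> B \<Longrightarrow> \<exists>x\<in>A. dist y x < e"
proof -
  \<comment> \<open>The strict bound passes to some member of the family whose infimum is
    \<open>infdist\<close>, so a near point exists without compactness.\<close>
  have *: "\<exists>y\<in>B. dist x y < e" if "infdist x B < e" "B \<noteq> {}" for x and B :: "'a set"
    using that by (simp add: infdist_notempty cINF_less_iff bdd_below_image_dist)
  have "(\<forall>x\<in>A. infdist x B \<le> hausdorff_dist A B) \<and> (\<forall>y\<in>B. infdist y A \<le> hausdorff_dist A B)"
    using hausdorff_dist_le_iff[OF assms(2-5)] by blast
  then show "x \<in> A \<Longrightarrow> \<exists>y\<in>B. dist x y < e" "y \<in> B \<Longrightarrow> \<exists>x\<in>A. dist y x < e"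
    using assms * by (meson order_le_less_trans)+
qed

text \<open>Assumption \<open>r\<close> says that the first ellipsoid contains the ball of radius
  \<open>r\<close> in \<open>V\<close>, so vectors shorter than \<open>lam * r\<close> lie in
  \<open>lam\<close> times that ellipsoid. Such a ball is assumed for the first ellipsoid only,
  since the second one varies in the continuity argument; this is why the two bounds differ in
  form.\<close>

lemma hausdorff_close_ellipsoids:
  fixes T T' S S' :: "'a fvec \<Rightarrow> 'a fvec" and I :: "'a set"
  defines "V \<equiv> coord_space I"
  assumes I: "finite I" and TS: "inverse_on V T S" and TS': "inverse_on V T' S'"
    and r: "r > 0" "\<And>x. x \<in> V \<Longrightarrow> r * norm (S x) \<le> norm x"
    and lam: "0 < lam" "lam < 1"
    and close: "hausdorff_dist (T ` unit_ball V) (T' ` unit_ball V) < lam * r"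
    and x: "x \<in> V"
  shows "norm (S' (T x)) \<le> (1 / (1 - lam)) * norm x"
    and "norm (S (T' x)) \<le> (1 + lam) * norm x"
proof -
  note D = inverse_onD[OF TS] and D' = inverse_onD[OF TS']
  have V: "subspace V" by (simp add: V_def)
  have ell: "compact (U ` unit_ball V) \<and> U ` unit_ball V \<noteq> {}" if "inverse_on V U U'" for U U'
    by (rule compact_ellipsoid[OF I, folded V_def])
       (use that in \<open>auto simp: ellipsoids_def GL_iff_inverse_on[OF V]\<close>)
  note near = hausdorff_dist_lessD[OF close]
  have S_small: "norm (S u) \<le> lam" if "u \<in> V" "norm u < lam * r" for u
  proof -
    have "r * norm (S u) \<le> r * lam"
      using r(2)[OF that(1)] that(2) by (simp add: mult.commute)
    then show ?thesis using r(1) by simp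
  qed
  have lST': "linear (\<lambda>x. S (T' x))" and lS'T: "linear (\<lambda>x. S' (T x))"
    using D(1,2) D'(1,2) linear_compose by (fastforce simp: o_def)+
  show "norm (S (T' x)) \<le> (1 + lam) * norm x"
  proof (rule norm_linear_le_scaled[OF lST' V _ x])
    fix x assume x: "x \<in> unit_ball V"
    then obtain y where y: "y \<in> unit_ball V" "dist (T' x) (T y) < lam * r"
      using near(2)[of "T' x"] ell[OF TS] ell[OF TS'] by (auto simp: compact_imp_bounded)
    have yx: "y \<in> V" "norm y \<le> 1" "x \<in> V"
      using x y(1) by (auto simp: unit_ball_def)
    \<comment> \<open>A point of the second ellipsoid is a point of the first plus an error in
      \<open>lam\<close> times the first.\<close>
    have "S (T' x) = y + S (T' x - T y)"
      by (simp add: linear_diff[OF D(2)] D yx)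
    moreover have "norm (S (T' x - T y)) \<le> lam"
      using y(2) by (intro S_small) (auto simp: dist_norm subspace_diff[OF V] D D' yx)
    ultimately show "norm (S (T' x)) \<le> 1 + lam"
      using yx(2) norm_triangle_mono by fastforce
  qed
  text \<open>The gauge of \<open>E'\<close> is at most \<open>1\<close> on \<open>E'\<close>, so its supremum \<open>M\<close> on
    \<open>E \<subseteq> E' + lam E\<close> satisfies \<open>M \<le> 1 + lam M\<close>.\<close>
  show "norm (S' (T x)) \<le> (1 / (1 - lam)) * norm x"
  proof (rule norm_linear_le_scaled[OF lS'T V _ x])
    define M where "M = (SUP x\<in>unit_ball V. norm (S' (T x)))"
    \<comment> \<open>The size of \<open>K\<close> is irrelevant: it only makes the supremum finite,
      so that \<open>M \<le> 1 + lam * M\<close> can be solved for \<open>M\<close>.\<close>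
    obtain K where K: "K > 0" "\<And>x. x \<in> V \<Longrightarrow> norm (S' (T x)) \<le> K * norm x"
      using linear_bounded_on_coord_space[OF I lS'T] unfolding V_def by blast
    have "norm (S' (T x)) \<le> K" if "x \<in> unit_ball V" for x
      using order_trans[OF K(2) mult_left_le] that K(1) by (simp add: unit_ball_def)
    then have "bdd_above ((\<lambda>x. norm (S' (T x))) ` unit_ball V)"
      by (rule bdd_aboveI2)
    then have M: "norm (S' (T x)) \<le> M" if "x \<in> unit_ball V" for x
      unfolding M_def by (rule cSUP_upper[OF that])
    have "norm (S' (T x)) \<le> 1 + lam * M" if x: "x \<in> unit_ball V" for x
    proof -
      obtain y where y: "y \<in> unit_ball V" "dist (T x) (T' y) < lam * r"
        using near(1)[of "T x"] ell[OF TS] ell[OF TS'] x by (auto simp: compact_imp_bounded)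
      have yx: "y \<in> V" "norm y \<le> 1" "x \<in> V"
        using x y(1) by (auto simp: unit_ball_def)
      let ?u = "T x - T' y"
      \<comment> \<open>Dividing the error by \<open>lam\<close> brings it back into the unit ball,
        where the bound \<open>M\<close> applies again.\<close>
      let ?w = "inverse lam *\<^sub>R S ?u"
      have u: "?u \<in> V"
        by (simp add: subspace_diff[OF V] D D' yx)
      have "norm (S ?u) \<le> lam"
        using y(2) by (intro S_small u) (simp add: dist_norm)
      then have w: "?w \<in> unit_ball V"
        using lam(1) by (simp add: unit_ball_def subspace_scale[OF V] D(4)[OF u] field_simps)
      have "S' (T x) = y + S' ?u"
        by (simp add: linear_diff[OF D'(2)] D' yx)
      also have "S' ?u = lam *\<^sub>R S' (T ?w)"
        using lam(1) by (simp add: linear_scale[OF D(1)] linear_scale[OF D'(2)] D(6)[OF u])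
      finally have "norm (S' (T x)) \<le> norm y + lam * norm (S' (T ?w))"
        using lam(1) by (metis norm_triangle_ineq norm_scaleR abs_of_pos)
      also have "\<dots> \<le> 1 + lam * M"
        using yx(2) M[OF w] lam(1) by (intro add_mono mult_left_mono) auto
      finally show ?thesis .
    qed
    then have "M \<le> 1 + lam * M"
      unfolding M_def using subspace_imp_zero_in_unit_ball[OF V] by (intro cSUP_least) auto
    then have "M \<le> 1 / (1 - lam)"
      using lam(2) by (simp add: field_simps)
    then show "norm (S' (T x)) \<le> 1 / (1 - lam)" if "x \<in> unit_ball V" for x
      using M[OF that] by simp
  qed
qed


section \<open>Tensor products of linear maps\<close>

lemma elem_tensor_cong: "(\<And>i. i < l \<Longrightarrow> x i = y i) \<Longrightarrow> elem_tensor l d x = elem_tensor l d y"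
  by (intro fvec_eqI) (simp add: coord_elem_tensor)

lemma multi_index_less: "k \<in> multi_index l d \<Longrightarrow> i < l \<Longrightarrow> k i < d i"
  by (auto simp: multi_index_def PiE_iff)

lemma tensor_map_cong:
  assumes "\<And>i x. i < l \<Longrightarrow> x \<in> Rn (d i) \<Longrightarrow> S i x = T i x"
  shows "tensor_map l d S z = tensor_map l d T z"
  unfolding tensor_map_def
  by (intro sum.cong refl arg_cong[of _ _ "scaleR _"] elem_tensor_cong assms)
     (auto simp: multi_index_less)

lemma tensor_map_in_tensor_space: "tensor_map l d T z \<in> tensor_space l d"
  unfolding tensor_map_def
  by (intro subspace_sum subspace_scale elem_tensor_in_tensor_space subspace_coord_space)

lemma tensor_map_ident:
  assumes "z \<in> tensor_space l d"
  shows "tensor_map l d (\<lambda>i x. x) z = z"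
  unfolding tensor_map_def
  by (subst (2) coord_space_expand[OF finite_multi_index assms])
     (intro sum.cong refl, simp flip: unit_vec_multi_index)

text \<open>By linearity it suffices to compare the two sides on the tensors of the vectors
  \<open>T i (unit_vec (k i))\<close>, where \<open>tensor_map_elem_tensor\<close> evaluates the
  outer map.\<close>

lemma tensor_map_compose:
  assumes "\<And>i. i < l \<Longrightarrow> linear (S i)" "\<And>i x. i < l \<Longrightarrow> x \<in> Rn (d i) \<Longrightarrow> T i x \<in> Rn (d i)"
  shows "tensor_map l d S (tensor_map l d T z) = tensor_map l d (\<lambda>i x. S i (T i x)) z"
proof -
  have "tensor_map l d S (elem_tensor l d (\<lambda>i. T i (unit_vec (k i)))) =
      elem_tensor l d (\<lambda>i. S i (T i (unit_vec (k i))))" if "k \<in> multi_index l d" for k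
    by (rule tensor_map_elem_tensor) (use that in \<open>auto intro!: assms simp: multi_index_less\<close>)
  then show ?thesis
    unfolding tensor_map_def[of l d T] tensor_map_def[of l d "\<lambda>i x. S i (T i x)"]
    by (simp add: linear_sum[OF linear_tensor_map] linear_scale[OF linear_tensor_map])
qed

text \<open>Functoriality: each composition is the tensor map of the factorwise compositions, which
  agree with the identity on every \<open>Rn (d i)\<close>.\<close>

lemma inverse_on_tensor_map:
  assumes "\<And>i. i < l \<Longrightarrow> inverse_on (Rn (d i)) (T i) (S i)"
  shows "inverse_on (tensor_space l d) (tensor_map l d T) (tensor_map l d S)"
proof -
  note D = inverse_onD[OF assms]
  have "tensor_map l d S (tensor_map l d T z) = z" "tensor_map l d T (tensor_map l d S z) = z"
    if z: "z \<in> tensor_space l d" for z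
  proof -
    have "tensor_map l d S (tensor_map l d T z) = tensor_map l d (\<lambda>i x. x) z"
      by (subst tensor_map_compose) (auto intro!: D tensor_map_cong)
    then show "tensor_map l d S (tensor_map l d T z) = z"
      by (simp add: tensor_map_ident[OF z])
    have "tensor_map l d T (tensor_map l d S z) = tensor_map l d (\<lambda>i x. x) z"
      by (subst tensor_map_compose) (auto intro!: D tensor_map_cong)
    then show "tensor_map l d T (tensor_map l d S z) = z"
      by (simp add: tensor_map_ident[OF z])
  qed
  then show ?thesis
    by (simp add: inverse_on_def linear_tensor_map tensor_map_in_tensor_space)
qed

section \<open>Operator norms of tensor products of maps\<close>

lemma norm_elem_tensor:
  assumes "\<And>i. i < l \<Longrightarrow> x i \<in> Rn (d i)"
  shows "norm (elem_tensor l d x) = (\<Prod>i<l. norm (x i))"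
proof -
  have "(norm (elem_tensor l d x))\<^sup>2 = (\<Prod>i<l. norm (x i))\<^sup>2"
    by (simp add: power2_norm_eq_inner inner_elem_tensor[OF assms] prod_power_distrib)
  then show ?thesis
    by (simp add: prod_nonneg)
qed

text \<open>The space splits orthogonally into copies of the \<open>i\<close>-th factor, one for each choice of the
  remaining indices, and the map acts as \<open>A\<close> on each copy.\<close>

lemma norm_tensor_map_one_factor_le:
  fixes A :: "nat fvec \<Rightarrow> nat fvec"
  assumes i: "i < l" and A: "linear A" "\<And>x. x \<in> Rn (d i) \<Longrightarrow> A x \<in> Rn (d i)"
    and c: "\<And>x. x \<in> Rn (d i) \<Longrightarrow> norm (A x) \<le> c * norm x"
    and c0: "c \<ge> 0"
    and z: "z \<in> tensor_space l d"
  shows "norm (tensor_map l d ((\<lambda>_ x. x)(i := A)) z) \<le> c * norm z"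
proof -
  let ?R = "{..<l} - {i}"
  let ?F = "tensor_map l d ((\<lambda>_ x. x)(i := A))"
  \<comment> \<open>\<open>G\<close> holds the choices of the remaining indices, \<open>J g\<close>
    embeds the \<open>i\<close>-th factor isometrically as the copy labelled by \<open>g\<close>,
    and \<open>s g\<close> is the component of \<open>z\<close> in that copy.\<close>
  define G where "G = (\<Pi>\<^sub>E j\<in>?R. {..<d j})"
  define J where "J g x = elem_tensor l d ((\<lambda>j. unit_vec (g j))(i := x))" for g :: "nat \<Rightarrow> nat" and x
  define s where "s g = (\<Sum>a<d i. coord z (g(i := a)) *\<^sub>R unit_vec a)" for g
  have finG: "finite G" by (auto simp: G_def intro: finite_PiE)
  have G_ext: "g = h" if "g \<in> G" "h \<in> G" "\<And>j. j \<in> ?R \<Longrightarrow> g j = h j" for g h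
    using that unfolding G_def by (rule PiE_ext)
  have restrict_G: "restrict k ?R \<in> G" if "k \<in> multi_index l d" for k
    using that by (auto simp: G_def multi_index_def PiE_iff)
  have mem: "((\<lambda>j. unit_vec (g j))(i := x)) j \<in> Rn (d j)"
    if "g \<in> G" "x \<in> Rn (d i)" "j < l" for g x j
    using that by (auto simp: G_def PiE_iff)
  have s: "s g \<in> Rn (d i)" for g
    unfolding s_def by (intro subspace_sum subspace_scale) auto
  have normJ: "norm (J g x) = norm x" if "g \<in> G" "x \<in> Rn (d i)" for g x
  proof -
    have "norm (J g x) = (\<Prod>j<l. norm (((\<lambda>j. unit_vec (g j))(i := x)) j))"
      unfolding J_def by (rule norm_elem_tensor) (rule mem[OF that])
    then show ?thesis using i by (simp add: prod.remove[of _ i])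
  qed
  have orth: "orthogonal (J g x) (J h y)"
    if gh: "g \<in> G" "x \<in> Rn (d i)" "h \<in> G" "g \<noteq> h" for g h x y
  proof -
    obtain j where j: "j \<in> ?R" "g j \<noteq> h j"
      using G_ext[OF gh(1,3)] gh(4) by blast
    have "inner (J g x) (J h y) =
        (\<Prod>j<l. inner (((\<lambda>j. unit_vec (g j))(i := x)) j) (((\<lambda>j. unit_vec (h j))(i := y)) j))"
      unfolding J_def by (rule inner_elem_tensor) (rule mem[OF gh(1,2)])
    moreover have "\<exists>j\<in>{..<l}. inner (((\<lambda>j. unit_vec (g j))(i := x)) j) (((\<lambda>j. unit_vec (h j))(i := y)) j) = 0"
      using j by (intro bexI[of _ j]) auto
    ultimately show ?thesis
      unfolding orthogonal_def by (simp only: prod_zero finite_lessThan)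
  qed
  have FJ: "?F (J g x) = J g (A x)" if "g \<in> G" "x \<in> Rn (d i)" for g x
  proof -
    have "?F (J g x) = elem_tensor l d (\<lambda>j. ((\<lambda>_ x. x)(i := A)) j (((\<lambda>j. unit_vec (g j))(i := x)) j))"
      unfolding J_def
      by (rule tensor_map_elem_tensor) (use A(1) mem[OF that] linear_id in \<open>auto simp: id_def\<close>)
    also have "\<dots> = J g (A x)"
      unfolding J_def by (rule elem_tensor_cong) auto
    finally show ?thesis .
  qed
  have coordJ: "coord (J g x) k = (if g = restrict k ?R then coord x (k i) else 0)"
    if kg: "k \<in> multi_index l d" "g \<in> G" for g x k
  proof -
    have "coord (J g x) k = coord x (k i) * (\<Prod>j\<in>?R. if k j = g j then 1 else 0)"
      using kg(1) i by (simp add: J_def coord_elem_tensor prod.remove[of _ i])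
    also have "(\<Prod>j\<in>?R. if k j = g j then 1 else 0) = (if g = restrict k ?R then 1 else (0::real))"
    proof (cases "g = restrict k ?R")
      case False
      then obtain j where "j \<in> ?R" "g j \<noteq> k j"
        using G_ext[OF kg(2) restrict_G[OF kg(1)]] by auto
      then have "\<exists>j\<in>?R. (if k j = g j then 1 else 0) = (0::real)" by force
      then show ?thesis using False by (simp add: prod_zero)
    qed (auto intro: prod.neutral)
    finally show ?thesis by simp
  qed
  have zJ: "z = (\<Sum>g\<in>G. J g (s g))"
  proof (rule fvec_eqI)
    fix k
    show "coord z k = coord (\<Sum>g\<in>G. J g (s g)) k"
    proof (cases "k \<in> multi_index l d")
      case True
      let ?g = "restrict k ?R"
      have g: "?g \<in> G" "k i < d i"
        using restrict_G[OF True] multi_index_less[OF True i] by auto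
      have k: "?g(i := k i) = k"
        using True by (auto simp: multi_index_def PiE_iff extensional_def fun_eq_iff)
      have "coord (\<Sum>g\<in>G. J g (s g)) k = (\<Sum>g\<in>G. if g = ?g then coord (s g) (k i) else 0)"
        using True by (simp add: coordJ)
      also have "\<dots> = coord (s ?g) (k i)"
        using g(1) finG by (simp add: sum.delta)
      also have "\<dots> = coord z (?g(i := k i))"
        using g(2) by (simp add: s_def if_distrib sum.delta' cong: if_cong)
      finally show ?thesis by (simp add: k)
    next
      case False
      then show ?thesis
        using z by (simp add: J_def coord_elem_tensor coord_space_def)
    qed
  qed
  \<comment> \<open>Used twice: with \<open>s\<close> it computes the norm of \<open>z\<close>, with
    \<open>A (s g)\<close> the norm of the image.\<close>
  have pyth: "(norm (\<Sum>g\<in>G. J g (x g)))\<^sup>2 = (\<Sum>g\<in>G. (norm (x g))\<^sup>2)"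
    if "\<And>g. x g \<in> Rn (d i)" for x
    using norm_sum_Pythagorean[OF finG, of "\<lambda>g. J g (x g)"] orth that
    by (simp add: pairwise_def normJ)
  have "?F z = (\<Sum>g\<in>G. J g (A (s g)))"
    by (subst zJ) (simp add: linear_sum[OF linear_tensor_map] FJ s)
  then have "(norm (?F z))\<^sup>2 = (\<Sum>g\<in>G. (norm (A (s g)))\<^sup>2)"
    by (simp add: pyth A(2) s)
  also have "\<dots> \<le> (\<Sum>g\<in>G. (c * norm (s g))\<^sup>2)"
    by (intro sum_mono power_mono c s) auto
  also have "\<dots> = (c * norm (\<Sum>g\<in>G. J g (s g)))\<^sup>2"
    by (simp add: power_mult_distrib pyth[OF s] sum_distrib_left)
  finally have "(norm (?F z))\<^sup>2 \<le> (c * norm z)\<^sup>2"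
    by (simp only: zJ[symmetric])
  then show ?thesis
    by (rule power2_le_imp_le) (simp add: c0)
qed

text \<open>The map is a composition of maps acting on one factor each. The induction on
  \<open>m\<close> applies \<open>A\<close> to the first \<open>m\<close> factors and the identity
  to the others; every new factor contributes \<open>c m\<close>.\<close>

lemma norm_tensor_map_le:
  fixes A :: "nat \<Rightarrow> nat fvec \<Rightarrow> nat fvec"
  assumes A: "\<And>i. i < l \<Longrightarrow> linear (A i)" "\<And>i x. i < l \<Longrightarrow> x \<in> Rn (d i) \<Longrightarrow> A i x \<in> Rn (d i)"
    and c: "\<And>i x. i < l \<Longrightarrow> x \<in> Rn (d i) \<Longrightarrow> norm (A i x) \<le> c i * norm x"
    and c0: "\<And>i. i < l \<Longrightarrow> c i \<ge> 0"
    and z: "z \<in> tensor_space l d"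
  shows "norm (tensor_map l d A z) \<le> (\<Prod>i<l. c i) * norm z"
proof -
  have "norm (tensor_map l d (\<lambda>i x. if i < m then A i x else x) z) \<le> (\<Prod>i<m. c i) * norm z"
    if "m \<le> l" for m
    using that
  proof (induction m)
    case 0
    then show ?case by (simp add: tensor_map_ident[OF z])
  next
    case (Suc m)
    let ?B = "\<lambda>i x. if i < m then A i x else x"
    \<comment> \<open>\<open>?B\<close> leaves factor \<open>m\<close> fixed, so the action of
      \<open>A m\<close> can be split off as an outer map.\<close>
    have "tensor_map l d (\<lambda>i x. if i < Suc m then A i x else x) z =
        tensor_map l d (\<lambda>i x. ((\<lambda>_ x. x)(m := A m)) i (?B i x)) z"
      by (rule tensor_map_cong) (auto simp: less_Suc_eq)
    also have "\<dots> = tensor_map l d ((\<lambda>_ x. x)(m := A m)) (tensor_map l d ?B z)"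
      using Suc.prems A linear_id by (subst tensor_map_compose) (auto simp: id_def)
    also have "norm \<dots> \<le> c m * norm (tensor_map l d ?B z)"
      using Suc.prems by (intro norm_tensor_map_one_factor_le A c c0 tensor_map_in_tensor_space) auto
    also have "\<dots> \<le> c m * ((\<Prod>i<m. c i) * norm z)"
      using Suc c0 by (intro mult_left_mono) auto
    finally show ?case by (simp add: mult_ac)
  qed
  from this[OF order_refl] show ?thesis
    by (subst tensor_map_cong[of l d A "\<lambda>i x. if i < l then A i x else x"]) auto
qed


section \<open>The Hilbertian tensor product\<close>

lemma elem_tensor_in_image:
  assumes T: "\<And>i. i < l \<Longrightarrow> linear (T i)" and x: "\<And>i. i < l \<Longrightarrow> x i \<in> T i ` unit_ball (Rn (d i))"
  shows "elem_tensor l d x \<in> tensor_map l d T ` unit_ball (tensor_space l d)"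
proof -
  have "\<forall>i. i < l \<longrightarrow> (\<exists>y. y \<in> unit_ball (Rn (d i)) \<and> x i = T i y)"
    using x by blast
  then obtain y where y: "\<And>i. i < l \<Longrightarrow> y i \<in> unit_ball (Rn (d i)) \<and> x i = T i (y i)"
    by metis
  have yR: "y i \<in> Rn (d i)" "norm (y i) \<le> 1" if "i < l" for i
    using y[OF that] by (auto simp: unit_ball_def)
  have "elem_tensor l d x = elem_tensor l d (\<lambda>i. T i (y i))"
    using y by (intro elem_tensor_cong) simp
  also have "\<dots> = tensor_map l d T (elem_tensor l d y)"
    by (simp add: tensor_map_elem_tensor T yR)
  finally have *: "elem_tensor l d x = tensor_map l d T (elem_tensor l d y)" .
  have "norm (elem_tensor l d y) \<le> 1"
    by (subst norm_elem_tensor) (auto intro!: yR prod_le_1)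
  then show ?thesis
    unfolding * by (intro imageI) (simp add: unit_ball_def elem_tensor_in_tensor_space)
qed

text \<open>The maps \<open>T i\<close> are moved to the other side of the inner product by their
  adjoints. Membership of \<open>y i\<close> in the polar bounds the norm of its adjoint image by
  \<open>1\<close>, and Cauchy-Schwarz finishes.\<close>

lemma inner_elem_tensor_image_le_1:
  assumes T: "\<And>i. i < l \<Longrightarrow> linear (T i)"
    and y: "\<And>i. i < l \<Longrightarrow> y i \<in> polar (Rn (d i)) (T i ` unit_ball (Rn (d i)))"
    and w: "w \<in> tensor_map l d T ` unit_ball (tensor_space l d)"
  shows "inner (elem_tensor l d y) w \<le> 1"
proof -
  obtain u where u: "w = tensor_map l d T u" "u \<in> tensor_space l d" "norm u \<le> 1"
    using w by (auto simp: unit_ball_def)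
  have yR: "y i \<in> Rn (d i)" if "i < l" for i
    using y[OF that] by (simp add: polar_def)
  define v where "v i = (\<Sum>a<d i. inner (y i) (T i (unit_vec a)) *\<^sub>R unit_vec a)" for i
  have v: "v i \<in> Rn (d i)" for i
    unfolding v_def by (intro subspace_sum subspace_scale) auto
  have coord_v: "coord (v i) a = inner (y i) (T i (unit_vec a))" if "a < d i" for i a
    using that by (simp add: v_def if_distrib sum.delta' cong: if_cong)
  text \<open>\<open>v i\<close> is the adjoint of \<open>T i\<close> applied to \<open>y i\<close>.\<close>
  have adj: "inner (v i) x = inner (T i x) (y i)" if "i < l" "x \<in> Rn (d i)" for i x
  proof -
    have "T i x = (\<Sum>a<d i. coord x a *\<^sub>R T i (unit_vec a))"
      by (subst coord_space_expand[OF finite_lessThan that(2)])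
         (simp add: linear_sum[OF T[OF that(1)]] linear_scale[OF T[OF that(1)]])
    then show ?thesis
      by (simp add: v_def inner_sum_left inner_commute[of "y i"] mult.commute)
  qed
  have "norm (v i) \<le> 1" if "i < l" for i
  proof (cases "v i = 0")
    case False
    \<comment> \<open>The functional given by \<open>v i\<close> attains its maximum over the unit
      ball, namely \<open>norm (v i)\<close>, at this vector.\<close>
    have "inverse (norm (v i)) *\<^sub>R v i \<in> unit_ball (Rn (d i))"
      using False v by (simp add: unit_ball_def subspace_scale)
    then have "inner (T i (inverse (norm (v i)) *\<^sub>R v i)) (y i) \<le> 1"
      using y[OF that] by (simp add: polar_def)
    then have "inner (v i) (inverse (norm (v i)) *\<^sub>R v i) \<le> 1"
      by (subst adj[OF that]) (auto simp: v subspace_scale)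
    then show ?thesis
      using False by (simp add: power2_norm_eq_inner[symmetric] power2_eq_square field_simps)
  qed simp
  then have "norm (elem_tensor l d v) \<le> 1"
    by (subst norm_elem_tensor) (auto intro!: v prod_le_1)
  have "inner (elem_tensor l d y) w = (\<Sum>k\<in>multi_index l d. coord u k *
      (\<Prod>i<l. inner (y i) (T i (unit_vec (k i)))))"
    by (simp add: u(1) tensor_map_def inner_sum_right inner_elem_tensor yR)
  also have "\<dots> = (\<Sum>k\<in>multi_index l d. coord u k * coord (elem_tensor l d v) k)"
    by (simp add: coord_elem_tensor coord_v multi_index_less)
  also have "\<dots> = inner u (elem_tensor l d v)"
    by (simp add: inner_coord_space[OF finite_multi_index u(2)])
  also have "\<dots> \<le> norm u * norm (elem_tensor l d v)"
    by (rule norm_cauchy_schwarz)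
  also have "\<dots> \<le> 1"
    using u(3) \<open>norm (elem_tensor l d v) \<le> 1\<close> by (simp add: mult_le_one)
  finally show ?thesis .
qed

text \<open>Replaces the choice hidden in \<open>hilbert_tensor\<close> by maps that come with
  inverses; \<open>hilbert_tensor_eq\<close> permits this.\<close>

lemma ellipsoid_family_maps:
  assumes "\<And>i. i < l \<Longrightarrow> E i \<in> ellipsoids (Rn (d i))"
  obtains T S where "\<forall>i<l. inverse_on (Rn (d i)) (T i) (S i)"
    "\<forall>i<l. E i = T i ` unit_ball (Rn (d i))"
    "hilbert_tensor l d E = tensor_map l d T ` unit_ball (tensor_space l d)"
proof -
  have "\<exists>T S. inverse_on (Rn (d i)) T S \<and> E i = T ` unit_ball (Rn (d i))" if "i < l" for i
    using assms[OF that] unfolding ellipsoids_def GL_iff_inverse_on[OF subspace_coord_space] by blast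
  then obtain T S where TS: "\<And>i. i < l \<Longrightarrow> inverse_on (Rn (d i)) (T i) (S i)"
      and E: "\<And>i. i < l \<Longrightarrow> E i = T i ` unit_ball (Rn (d i))"
    by metis
  have "hilbert_tensor l d E = tensor_map l d T ` unit_ball (tensor_space l d)"
    by (rule hilbert_tensor_eq) (use TS E in \<open>auto simp: GL_iff_inverse_on\<close>)
  then show thesis using TS E by (intro that[of T S]) simp_all
qed

text \<open>The bodies \<open>E i\<close> themselves serve as the witnesses for
  tensoriality.\<close>

lemma hilbert_tensor_in_tensorial_ellipsoids:
  assumes E: "\<And>i. i < l \<Longrightarrow> E i \<in> ellipsoids (Rn (d i))"
  shows "hilbert_tensor l d E \<in> tensorial_ellipsoids l d"
proof -
  let ?Q = "hilbert_tensor l d E"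
  obtain T S where maps: "\<forall>i<l. inverse_on (Rn (d i)) (T i) (S i)"
      "\<forall>i<l. E i = T i ` unit_ball (Rn (d i))"
    and Q: "?Q = tensor_map l d T ` unit_ball (tensor_space l d)"
    by (rule ellipsoid_family_maps[OF E])
  have TS: "inverse_on (Rn (d i)) (T i) (S i)" and ET: "E i = T i ` unit_ball (Rn (d i))"
    if "i < l" for i
    using maps that by auto
  have lT: "linear (T i)" if "i < l" for i
    using inverse_onD(1)[OF TS[OF that]] .
  have "inverse_on (tensor_space l d) (tensor_map l d T) (tensor_map l d S)"
    by (rule inverse_on_tensor_map) (rule TS)
  then have Qe: "?Q \<in> ellipsoids (tensor_space l d)"
    unfolding Q ellipsoids_def GL_iff_inverse_on[OF subspace_coord_space] by blast
  then have Qb: "?Q \<in> sym_convex_bodies (tensor_space l d)"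
    by (intro ellipsoid_sym_convex_body) simp_all
  have "proj_tensor l d E \<subseteq> ?Q"
    unfolding proj_tensor_def
  proof (rule hull_minimal)
    show "{elem_tensor l d x |x. \<forall>i<l. x i \<in> E i} \<subseteq> ?Q"
      unfolding Q using ET by (auto intro!: elem_tensor_in_image lT)
    show "convex ?Q"
      using Qb by (simp add: sym_convex_bodies_def)
  qed
  moreover have "?Q \<subseteq> inj_tensor l d E"
  proof
    fix w assume w: "w \<in> ?Q"
    \<comment> \<open>The half-space cut out by \<open>w\<close> is convex, so only elementary
      tensors of polar vectors have to be tested.\<close>
    have "proj_tensor l d (\<lambda>i. polar (Rn (d i)) (E i)) \<subseteq> {v. inner w v \<le> 1}"
      unfolding proj_tensor_def
    proof (rule hull_minimal)
      show "{elem_tensor l d x |x. \<forall>i<l. x i \<in> polar (Rn (d i)) (E i)} \<subseteq> {v. inner w v \<le> 1}"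
        using w ET unfolding Q
        by (auto simp: inner_commute[of w] intro!: inner_elem_tensor_image_le_1[where T = T] lT)
    qed (rule convex_halfspace_le)
    moreover have "w \<in> tensor_space l d"
      using w Qb by (auto simp: sym_convex_bodies_def)
    ultimately show "w \<in> inj_tensor l d E"
      by (auto simp: inj_tensor_def polar_def inner_commute[of _ w])
  qed
  moreover have "\<forall>i<l. E i \<in> sym_convex_bodies (Rn (d i))"
    using E by (auto intro: ellipsoid_sym_convex_body)
  ultimately show ?thesis
    using Qe Qb by (auto simp: tensorial_ellipsoids_def tensorial_body_def)
qed

text \<open>The gauge of the target is the norm after \<open>tensor_map l d S'\<close>. On the
  source it is at most \<open>c ^ l\<close>, one factor \<open>c\<close> for each of the
  \<open>l\<close> maps \<open>S' i (T i x)\<close>.\<close>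

lemma tensor_map_image_subset_scaled:
  assumes TS: "\<And>i. i < l \<Longrightarrow> inverse_on (Rn (d i)) (T i) (S i)"
    and TS': "\<And>i. i < l \<Longrightarrow> inverse_on (Rn (d i)) (T' i) (S' i)"
    and le: "\<And>i x. i < l \<Longrightarrow> x \<in> Rn (d i) \<Longrightarrow> norm (S' i (T i x)) \<le> c * norm x"
    and c: "c > 0"
    and x: "x \<in> tensor_map l d T ` unit_ball (tensor_space l d)"
  shows "inverse (c ^ l) *\<^sub>R x \<in> tensor_map l d T' ` unit_ball (tensor_space l d)"
proof -
  let ?V = "tensor_space l d"
  note D = inverse_onD[OF TS] and D' = inverse_onD[OF TS']
  obtain z where z: "z \<in> ?V" "norm z \<le> 1" "x = tensor_map l d T z"
    using x by (auto simp: unit_ball_def)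
  have "tensor_map l d S' x = tensor_map l d (\<lambda>i x. S' i (T i x)) z"
    unfolding z(3) by (rule tensor_map_compose) (auto intro: D D')
  also have "norm \<dots> \<le> (\<Prod>i<l. c) * norm z"
    using c z(1) linear_compose[OF D(1) D'(2), unfolded o_def]
    by (intro norm_tensor_map_le) (auto intro: D D' le)
  also have "\<dots> \<le> c ^ l"
    using c z(2) by (simp add: mult_left_le)
  finally have "norm (tensor_map l d S' (inverse (c ^ l) *\<^sub>R x)) \<le> 1"
    using c by (simp add: linear_scale[OF linear_tensor_map] field_simps)
  then show ?thesis
    by (intro mem_linear_image_unit_ball[OF inverse_on_tensor_map[OF TS']])
       (auto simp: z(3) subspace_scale tensor_map_in_tensor_space)
qed

section \<open>Continuity at a family of ellipsoids\<close>

theorem proposition2p4: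
  fixes l :: nat and d :: "nat \<Rightarrow> nat"
  assumes "l \<ge> 1" and "\<And>i. i < l \<Longrightarrow> d i \<ge> 2"
  shows "continuous_map
    (product_topology (\<lambda>i. hausdorff_topology (ellipsoids (Rn (d i)))) {..<l})
    (hausdorff_topology (tensorial_ellipsoids l d))
    (hilbert_tensor l d)"
proof -
  let ?X = "product_topology (\<lambda>i. hausdorff_topology (ellipsoids (Rn (d i)))) {..<l}"
  let ?V = "tensor_space l d"
  interpret Q: Metric_space "tensorial_ellipsoids l d" hausdorff_dist
    by (rule Metric_space_ellipsoids)
  have top: "topspace ?X = (\<Pi>\<^sub>E i\<in>{..<l}. ellipsoids (Rn (d i)))"
    by (simp add: hausdorff_topology_def Metric_space.topspace_mtopology[OF Metric_space_ellipsoids(1)])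
  have "\<exists>U. openin ?X U \<and> E \<in> U \<and>
      (\<forall>F\<in>U. hilbert_tensor l d F \<in> Q.mball (hilbert_tensor l d E) e)"
    if E: "E \<in> topspace ?X" and e: "e > 0" for E e
  proof -
    have EE: "E i \<in> ellipsoids (Rn (d i))" if "i < l" for i
      using E that unfolding top by auto
    obtain T S where maps: "\<forall>i<l. inverse_on (Rn (d i)) (T i) (S i)"
        "\<forall>i<l. E i = T i ` unit_ball (Rn (d i))"
      and QE: "hilbert_tensor l d E = tensor_map l d T ` unit_ball ?V"
      by (rule ellipsoid_family_maps[OF EE])
    have TS: "inverse_on (Rn (d i)) (T i) (S i)" and ET: "E i = T i ` unit_ball (Rn (d i))"
      if "i < l" for i
      using maps that by auto
    have compact_Q: "compact Q \<and> Q \<noteq> {}" if "Q \<in> tensorial_ellipsoids l d" for Q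
      using that compact_ellipsoid[OF finite_multi_index] by (auto simp: tensorial_ellipsoids_def)
    have QE_mem: "hilbert_tensor l d E \<in> tensorial_ellipsoids l d"
      by (rule hilbert_tensor_in_tensorial_ellipsoids[OF EE])
    \<comment> \<open>The radius \<open>R\<close> converts the relative errors of the scaled
      inclusions into distances.\<close>
    obtain R where R: "R > 0" "\<And>x. x \<in> hilbert_tensor l d E \<Longrightarrow> norm x \<le> R"
      using compact_Q[OF QE_mem] compact_imp_bounded bounded_pos by metis
    \<comment> \<open>Every \<open>E i\<close> contains a ball around \<open>0\<close>, whose radius
      is the reciprocal of a bound for the inverse map.\<close>
    have "\<exists>r>0. \<forall>x\<in>Rn (d i). r * norm (S i x) \<le> norm x" if i: "i < l" for i
    proof -
      obtain K where K: "K > 0" "\<And>x. x \<in> Rn (d i) \<Longrightarrow> norm (S i x) \<le> K * norm x"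
        using linear_bounded_on_coord_space[OF finite_lessThan inverse_onD(2)[OF TS[OF i]]] by blast
      then show ?thesis
        by (intro exI[of _ "1 / K"]) (auto simp: field_simps)
    qed
    then obtain r where r: "\<And>i. i < l \<Longrightarrow> r i > 0"
        "\<And>i x. i < l \<Longrightarrow> x \<in> Rn (d i) \<Longrightarrow> r i * norm (S i x) \<le> norm x"
      by metis
    have lim: "((\<lambda>t. (1 - (1 - t) ^ l) * R) \<longlongrightarrow> (1 - (1 - 0) ^ l) * R) (at_right 0)"
      "((\<lambda>t. ((1 + t) ^ l - 1) * R) \<longlongrightarrow> ((1 + 0) ^ l - 1) * R) (at_right 0)"
      by (intro tendsto_intros)+
    \<comment> \<open>Both errors tend to \<open>0\<close>. The bound \<open>e / 2\<close> leaves
      room because the estimate of \<open>hausdorff_dist\<close> below is not strict, while the ball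
      of radius \<open>e\<close> is open.\<close>
    have "\<forall>\<^sub>F t in at_right 0. (1 - (1 - t) ^ l) * R < e / 2"
      "\<forall>\<^sub>F t in at_right 0. ((1 + t) ^ l - 1) * R < e / 2"
      using order_tendstoD(2)[OF lim(1), of "e / 2"] order_tendstoD(2)[OF lim(2), of "e / 2"] e
      by simp_all
    moreover have "\<forall>\<^sub>F t::real in at_right 0. 0 < t \<and> t < 1"
      by (auto simp: eventually_at_right_field intro: exI[of _ 1])
    ultimately have "\<forall>\<^sub>F t in at_right 0. 0 < t \<and> t < 1 \<and>
        (1 - (1 - t) ^ l) * R < e / 2 \<and> ((1 + t) ^ l - 1) * R < e / 2"
      by eventually_elim auto
    then obtain t where t: "0 < t" "t < 1" "(1 - (1 - t) ^ l) * R < e / 2" "((1 + t) ^ l - 1) * R < e / 2"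
      using eventually_happens'[OF trivial_limit_at_right_real] by blast
    \<comment> \<open>The radii are scaled by \<open>r i\<close> so that one relative error
      \<open>t\<close> serves all factors; the product is open because there are finitely
      many.\<close>
    let ?U = "\<Pi>\<^sub>E i\<in>{..<l}. Metric_space.mball (ellipsoids (Rn (d i))) hausdorff_dist (E i) (t * r i)"
    have "openin ?X ?U"
      unfolding openin_PiE[OF finite_lessThan]
      by (simp add: hausdorff_topology_def Metric_space.openin_mball[OF Metric_space_ellipsoids(1)])
    moreover have "E \<in> ?U"
      using E t(1) r(1) EE unfolding top
      by (auto simp: PiE_iff Metric_space.centre_in_mball_iff[OF Metric_space_ellipsoids(1)])
    moreover have "hilbert_tensor l d F \<in> Q.mball (hilbert_tensor l d E) e" if F: "F \<in> ?U" for F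
    proof -
      have FE: "F i \<in> ellipsoids (Rn (d i))" "hausdorff_dist (E i) (F i) < t * r i" if "i < l" for i
        using F that
        by (auto simp: PiE_iff Metric_space.in_mball[OF Metric_space_ellipsoids(1)])
      obtain T' S' where maps: "\<forall>i<l. inverse_on (Rn (d i)) (T' i) (S' i)"
          "\<forall>i<l. F i = T' i ` unit_ball (Rn (d i))"
        and QF: "hilbert_tensor l d F = tensor_map l d T' ` unit_ball ?V"
        by (rule ellipsoid_family_maps[OF FE(1)])
      have TS': "inverse_on (Rn (d i)) (T' i) (S' i)" and FT: "F i = T' i ` unit_ball (Rn (d i))"
        if "i < l" for i
        using maps that by auto
      have QF_mem: "hilbert_tensor l d F \<in> tensorial_ellipsoids l d"
        by (rule hilbert_tensor_in_tensorial_ellipsoids[OF FE(1)])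
      have le: "norm (S' i (T i x)) \<le> (1 / (1 - t)) * norm x" "norm (S i (T' i x)) \<le> (1 + t) * norm x"
        if "i < l" "x \<in> Rn (d i)" for i x
        using hausdorff_close_ellipsoids[OF finite_lessThan TS[OF that(1)] TS'[OF that(1)]
            r(1)[OF that(1)] r(2)[OF that(1)] t(1,2) _ that(2)]
          FE(2)[OF that(1), unfolded ET[OF that(1)] FT[OF that(1)]] by auto
      have "infdist x (hilbert_tensor l d F) \<le> e / 2" if x: "x \<in> hilbert_tensor l d E" for x
      proof -
        have "inverse ((1 / (1 - t)) ^ l) *\<^sub>R x \<in> hilbert_tensor l d F"
          unfolding QF using x t(2)
          by (intro tensor_map_image_subset_scaled[OF TS TS' le(1)]) (auto simp: QE)
        then have "(1 - t) ^ l *\<^sub>R x \<in> hilbert_tensor l d F"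
          by (simp add: power_one_over)
        then have "infdist x (hilbert_tensor l d F) \<le> norm ((1 - (1 - t) ^ l) *\<^sub>R x)"
          using infdist_le[of _ _ x] by (simp add: dist_norm scaleR_left_diff_distrib)
        also have "\<dots> \<le> (1 - (1 - t) ^ l) * R"
          using t(1,2) R(2)[OF x] by (simp add: power_le_one mult_left_mono)
        finally show ?thesis using t(3) by simp
      qed
      moreover have "infdist y (hilbert_tensor l d E) \<le> e / 2" if y: "y \<in> hilbert_tensor l d F" for y
      proof -
        \<comment> \<open>The distance is measured through \<open>?x\<close> instead of
          \<open>y\<close>, because \<open>R\<close> bounds the tensor product of the
          \<open>E i\<close> and not the one that varies.\<close>
        let ?x = "inverse ((1 + t) ^ l) *\<^sub>R y"
        have x: "?x \<in> hilbert_tensor l d E"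
          unfolding QE using y t(1)
          by (intro tensor_map_image_subset_scaled[OF TS' TS le(2)]) (auto simp: QF)
        have "y - ?x = ((1 + t) ^ l - 1) *\<^sub>R ?x"
        proof -
          have "y = (1 + t) ^ l *\<^sub>R ?x"
            using t(1) by simp
          then show ?thesis
            by (metis scaleR_left_diff_distrib scaleR_one)
        qed
        then have "infdist y (hilbert_tensor l d E) \<le> norm (((1 + t) ^ l - 1) *\<^sub>R ?x)"
          using infdist_le[OF x, of y] by (simp only: dist_norm)
        also have "\<dots> = ((1 + t) ^ l - 1) * norm ?x"
          using t(1) by (simp only: norm_scaleR) (simp add: one_le_power)
        also have "\<dots> \<le> ((1 + t) ^ l - 1) * R"
          using t(1) R(2)[OF x] by (intro mult_left_mono) (auto simp: one_le_power)
        finally show ?thesis using t(4) by simp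
      qed
      ultimately have "hausdorff_dist (hilbert_tensor l d E) (hilbert_tensor l d F) \<le> e / 2"
        using compact_Q[OF QE_mem] compact_Q[OF QF_mem]
        by (subst hausdorff_dist_le_iff) (auto simp: compact_imp_bounded)
      then show ?thesis
        using e QE_mem QF_mem by (simp add: Q.in_mball)
    qed
    ultimately show ?thesis
      by (intro exI[of _ ?U] conjI ballI)
  qed
  then show ?thesis
    unfolding hausdorff_topology_def[of "tensorial_ellipsoids l d"] Q.continuous_map_to_metric
    by (intro ballI allI impI)
qed

end
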